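(* Let $(f_n)_{n\in\mathbb{N}}$ be a martingale on a filtered probability space $(\Omega,(\mathcal{F}_n)_{n\in\mathbb{N}})$ with values in a Hilbert space $(H,|\cdot|)$ and with $f_0=0$. Let $r\in[1,2]$, let $w$ be an integrable weight, and let $w_n=\mathbb{E}(w|\mathcal{F}_n)$. Let $N\in\mathbb{N}$ and $Sf := \bigl(\sum_{n=1}^{N} |df_n|^2\bigr)^{1/2}$. Then $$\mathbb{E}\bigl( (Sf)^r w \bigr) \leq 2^r \Bigl( \mathbb{E}\bigl( (f^* )^r w\bigr) \Bigr)^{1-r/2} \Bigl( \mathbb{E} \bigl( (f^* )^r w^*\bigr) \Bigr)^{r/2}.$$
   Context: Here $\mathbb{N}=\{0,1,2,\dots\}$. A weight is a positive random variable on $\Omega$. Notation: $df_n=f_n-f_{n-1}$ (for $n\geq 1$), $f^* = \sup_{n\in\mathbb{N}} |f_n|$, $w^*=\sup_{n\in\mathbb{N}} w_n = \sup_{n\in\mathbb{N}} \mathbb{E}(w|\mathcal{F}_n)$. Expectations of nonnegative random variables take values in $[0,\infty]$, and $a^0=1$ for every $a\in[0,\infty]$. *)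

theory Defs
  imports "HOL-Probability.Probability"
begin

text \<open>
  The library's \<^const>\<open>has_bochner_integral\<close> is only available for second-countable (separable) target
  spaces. The following is the same definition without that restriction, so that arbitrary Hilbert
  spaces are covered: \<open>f\<close> is measurable, and approximated in the mean by simple functions.
  The approximation forces \<open>f\<close> to be almost everywhere separably valued.
\<close>

definition has_bochner_int :: "'a measure \<Rightarrow> ('a \<Rightarrow> 'b::real_normed_vector) \<Rightarrow> 'b \<Rightarrow> bool" where
  "has_bochner_int M f I \<longleftrightarrow> f \<in> borel_measurable M \<and>
     (\<exists>s. (\<forall>i::nat. Bochner_Integration.simple_bochner_integrable M (s i)) \<and>
          (\<lambda>i. \<integral>\<^sup>+x. ennreal (norm (f x - s i x)) \<partial>M) \<longlonglongrightarrow> 0 \<and>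
          (\<lambda>i. Bochner_Integration.simple_bochner_integral M (s i)) \<longlonglongrightarrow> I)"

lemma has_bochner_int_iff_has_bochner_integral:
  fixes f :: "'a \<Rightarrow> 'b::{real_normed_vector, second_countable_topology}"
  shows "has_bochner_int M f I \<longleftrightarrow> has_bochner_integral M f I"
  unfolding has_bochner_int_def has_bochner_integral.simps by auto

definition bochner_integrable :: "'a measure \<Rightarrow> ('a \<Rightarrow> 'b::real_normed_vector) \<Rightarrow> bool" where
  "bochner_integrable M f \<longleftrightarrow> (\<exists>I. has_bochner_int M f I)"

text \<open>
  \<open>g\<close> is a version of the conditional expectation of \<open>f\<close> given the sub-\<open>\<sigma>\<close>-algebra \<open>G\<close>;
  only the sets of the measure \<open>G\<close> matter.
\<close>

definition is_cond_exp ::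
    "'a measure \<Rightarrow> 'a measure \<Rightarrow> ('a \<Rightarrow> 'b::real_normed_vector) \<Rightarrow> ('a \<Rightarrow> 'b) \<Rightarrow> bool" where
  "is_cond_exp M G f g \<longleftrightarrow>
     bochner_integrable M f \<and> bochner_integrable M g \<and> g \<in> borel_measurable G \<and>
     (\<forall>A\<in>sets G. \<exists>I. has_bochner_int M (\<lambda>x. indicator A x *\<^sub>R f x) I \<and>
                     has_bochner_int M (\<lambda>x. indicator A x *\<^sub>R g x) I)"

definition martingale ::
    "'a measure \<Rightarrow> (nat \<Rightarrow> 'a measure) \<Rightarrow> (nat \<Rightarrow> 'a \<Rightarrow> 'b::real_normed_vector) \<Rightarrow> bool" where
  "martingale M F f \<longleftrightarrow>
     (\<forall>n. bochner_integrable M (f n) \<and> f n \<in> borel_measurable (F n)) \<and>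
     (\<forall>m n. m \<le> n \<longrightarrow> is_cond_exp M (F m) (f n) (f m))"

text \<open>
  Powers on \<open>[0,\<infinity>]\<close>, meant for exponents \<open>p \<ge> 0\<close>. The case \<open>p = 0\<close> is separate since
  \<open>0 powr 0 = 0\<close> in the library.
\<close>

definition ennreal_pow :: "ennreal \<Rightarrow> real \<Rightarrow> ennreal" where
  "ennreal_pow a p =
     (if p = 0 then 1 else if a = \<infinity> then \<infinity> else ennreal (enn2real a powr p))"

definition mdiff :: "(nat \<Rightarrow> 'a \<Rightarrow> 'b::ab_group_add) \<Rightarrow> nat \<Rightarrow> 'a \<Rightarrow> 'b" where
  "mdiff f n x = f n x - f (n - 1) x"

definition square_function :: "(nat \<Rightarrow> 'a \<Rightarrow> 'b::real_normed_vector) \<Rightarrow> nat \<Rightarrow> 'a \<Rightarrow> real" where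
  "square_function f N x = sqrt (\<Sum>n=1..N. (norm (mdiff f n x))\<^sup>2)"

definition maximal_function :: "(nat \<Rightarrow> 'a \<Rightarrow> 'b::real_normed_vector) \<Rightarrow> 'a \<Rightarrow> ennreal" where
  "maximal_function f x = (SUP n. ennreal (norm (f n x)))"

definition weight :: "'a measure \<Rightarrow> ('a \<Rightarrow> real) \<Rightarrow> bool" where
  "weight M w \<longleftrightarrow> w \<in> borel_measurable M \<and> (\<forall>x\<in>space M. w x > 0)"

definition maximal_weight ::
    "'a measure \<Rightarrow> (nat \<Rightarrow> 'a measure) \<Rightarrow> ('a \<Rightarrow> real) \<Rightarrow> 'a \<Rightarrow> ennreal" where
  "maximal_weight M F w x = (SUP n. ennreal (real_cond_exp M (F n) w x))"

end

theory Submission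
  imports Defs
begin

text \<open>
  Let \<open>Y n\<close> be the running maximum of the norms and \<open>V n\<close> an increasing adapted sequence of nonnegative
  weights. The potential \<open>G n = V n * (3 * Y n + (norm (f n))\<^sup>2 / Y n)\<close> increases in each step at least by
  \<open>V n * (norm (df n))\<^sup>2 / Y n\<close> plus the term \<open>2 * V (n-1) / Y (n-1) * inner (f (n-1)) (df n)\<close>, which
  has mean zero, and \<open>G n \<le> 4 * V n * Y n\<close>. Hence
  \<open>E (\<Sum>n. V n * (norm (df n))\<^sup>2 / Y n) \<le> 4 * E (V N * Y N)\<close>.
  Take \<open>V n = Y n powr (r - 1) * W n\<close> with \<open>W n\<close> the running maximum of \<open>E(w|F n)\<close>, and apply Hoelder's
  inequality with the exponent \<open>r / 2\<close> to
  \<open>(Sf)\<^sup>2 \<le> (\<Sum>n. (norm (df n))\<^sup>2 * Y n powr (r - 2)) * Y N powr (2 - r)\<close>.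
  As \<open>H\<close> need not be separable, \<open>f\<close> is first changed on a null set so as to take values in the
  closure of a countable set, and there only its scalar products with fixed vectors are used.
\<close>

section \<open>Approximation in a separable subset\<close>

text \<open>A point of \<open>0, e 0, ..., e (m - 1)\<close> closest to \<open>u\<close>. Starting
  from \<open>0\<close> bounds its norm by \<open>2 * norm u\<close>; each recursion step is decided
  by one comparison of distances, which suits measurability proofs by induction.\<close>

primrec nearest :: "(nat \<Rightarrow> 'h) \<Rightarrow> 'h \<Rightarrow> nat \<Rightarrow> 'h::real_normed_vector" where
  "nearest e u 0 = 0"
| "nearest e u (Suc m) =
    (if norm (u - e m) < norm (u - nearest e u m) then e m else nearest e u m)"

lemma norm_diff_nearest_Suc:
  "norm (u - nearest e u (Suc m)) = min (norm (u - e m)) (norm (u - nearest e u m))"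
  by auto

lemma norm_diff_nearest_le: "norm (u - nearest e u m) \<le> norm u"
  by (induction m) auto

lemma norm_nearest_le: "norm (nearest e u m) \<le> 2 * norm u"
  using norm_diff_nearest_le[of u e m] norm_triangle_ineq2[of "nearest e u m" u]
  by (simp add: norm_minus_commute)

lemma norm_diff_nearest_le_dist: "k < m \<Longrightarrow> norm (u - nearest e u m) \<le> norm (u - e k)"
  by (induction m) (auto simp: less_Suc_eq)

lemma nearest_tendsto:
  assumes "u \<in> closure (range e)"
  shows "(\<lambda>m. nearest e u m) \<longlonglongrightarrow> u"
proof (rule LIMSEQ_I)
  fix \<epsilon> :: real assume "0 < \<epsilon>"
  then obtain k where k: "norm (u - e k) < \<epsilon>"
    using assms by (auto simp: closure_approachable dist_norm norm_minus_commute)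
  show "\<exists>m0. \<forall>m\<ge>m0. norm (nearest e u m - u) < \<epsilon>"
  proof (intro exI allI impI)
    fix m assume "Suc k \<le> m"
    then show "norm (nearest e u m - u) < \<epsilon>"
      using norm_diff_nearest_le_dist[of k m u e] k by (simp add: norm_minus_commute)
  qed
qed

section \<open>Measurability of distances and scalar products\<close>

lemma borel_measurable_norm_diff_const:
  fixes u :: "'a \<Rightarrow> 'h::real_normed_vector"
  assumes "u \<in> borel_measurable N"
  shows "(\<lambda>x. norm (u x - c)) \<in> borel_measurable N"
  by (rule measurable_compose[OF assms]) (intro borel_measurable_continuous_onI continuous_intros)

lemma borel_measurable_inner_const:
  fixes u :: "'a \<Rightarrow> 'h::real_inner"
  assumes "u \<in> borel_measurable N"
  shows "(\<lambda>x. inner c (u x)) \<in> borel_measurable N"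
  by (rule measurable_compose[OF assms]) (intro borel_measurable_continuous_onI continuous_intros)

text \<open>By \<open>norm_diff_nearest_Suc\<close> the distance is a minimum of distances to fixed
  vectors, each a continuous function of \<open>u x\<close>.\<close>

lemma borel_measurable_norm_diff_nearest:
  assumes "u \<in> borel_measurable N"
  shows "(\<lambda>x. norm (u x - nearest e (u x) m)) \<in> borel_measurable N"
proof (induction m)
  case 0
  then show ?case using borel_measurable_norm_diff_const[OF assms, of 0] by simp
next
  case (Suc m)
  then show ?case
    using borel_measurable_norm_diff_const[OF assms, of "e m"]
    unfolding norm_diff_nearest_Suc by measurable
qed

lemma nearest_switch_sets:
  assumes "u \<in> borel_measurable N"
  shows "{x \<in> space N. norm (u x - e m) < norm (u x - nearest e (u x) m)} \<in> sets N"
  using borel_measurable_norm_diff_nearest[OF assms] borel_measurable_norm_diff_const[OF assms]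
  by measurable

lemma borel_measurable_inner_nearest:
  fixes u g :: "'a \<Rightarrow> 'h::real_inner"
  assumes u: "u \<in> borel_measurable N" and g: "g \<in> borel_measurable N"
  shows "(\<lambda>x. inner (nearest e (u x) m) (g x)) \<in> borel_measurable N"
proof (induction m)
  case 0
  then show ?case by simp
next
  case (Suc m)
  let ?B = "{x \<in> space N. norm (u x - e m) < norm (u x - nearest e (u x) m)}"
  have "(\<lambda>x. if x \<in> ?B then inner (e m) (g x) else inner (nearest e (u x) m) (g x))
      \<in> borel_measurable N"
    using Suc borel_measurable_inner_const[OF g] nearest_switch_sets[OF u]
    by (intro measurable_If_set) auto
  then show ?case
    by (rule measurable_cong[THEN iffD1, rotated]) auto
qed

text \<open>Without second countability, sums and inner products of Borel functions need not be Borel.\<close>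

lemma borel_measurable_inner_separable:
  fixes u g :: "'a \<Rightarrow> 'h::real_inner" and e :: "nat \<Rightarrow> 'h"
  assumes u: "u \<in> borel_measurable N" and g: "g \<in> borel_measurable N"
    and sep: "\<And>x. x \<in> space N \<Longrightarrow> u x \<in> closure (range e)"
  shows "(\<lambda>x. inner (u x) (g x)) \<in> borel_measurable N"
proof (rule borel_measurable_LIMSEQ_real)
  show "(\<lambda>m. inner (nearest e (u x) m) (g x)) \<longlonglongrightarrow> inner (u x) (g x)" if "x \<in> space N" for x
    by (intro tendsto_inner nearest_tendsto sep that tendsto_const)
qed (rule borel_measurable_inner_nearest[OF u g])

text \<open>Expanding the square reduces the distance to a scalar product, which
  \<open>borel_measurable_inner_separable\<close> covers.\<close>

lemma borel_measurable_norm_diff_separable: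
  fixes u g :: "'a \<Rightarrow> 'h::real_inner" and e :: "nat \<Rightarrow> 'h"
  assumes u: "u \<in> borel_measurable N" and g: "g \<in> borel_measurable N"
    and sep: "\<And>x. x \<in> space N \<Longrightarrow> u x \<in> closure (range e)"
  shows "(\<lambda>x. norm (g x - u x)) \<in> borel_measurable N"
proof -
  have "norm (g x - u x) = sqrt ((norm (g x))\<^sup>2 - 2 * inner (u x) (g x) + (norm (u x))\<^sup>2)" for x
    by (simp add: norm_eq_sqrt_inner inner_diff inner_commute)
  moreover have "(\<lambda>x. norm (g x)) \<in> borel_measurable N" "(\<lambda>x. norm (u x)) \<in> borel_measurable N"
    using borel_measurable_norm_diff_const[OF g, of 0] borel_measurable_norm_diff_const[OF u, of 0]
    by simp_all
  ultimately show ?thesis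
    using borel_measurable_inner_separable[OF assms] by simp
qed

section \<open>Bochner integrals in nonseparable spaces\<close>

text \<open>Taking the scalar product with a fixed vector is bounded and linear, so it carries the
  approximating simple functions over to real ones. This leads back to the ordinary theory of real
  integrals.\<close>

lemma has_bochner_int_inner:
  fixes f :: "'a \<Rightarrow> 'h::real_inner"
  assumes "has_bochner_int M f I"
  shows "has_bochner_integral M (\<lambda>x. inner c (f x)) (inner c I)"
proof -
  from assms obtain s where f: "f \<in> borel_measurable M"
    and s: "\<And>i. Bochner_Integration.simple_bochner_integrable M (s i)"
    and lim: "(\<lambda>i. \<integral>\<^sup>+x. ennreal (norm (f x - s i x)) \<partial>M) \<longlonglongrightarrow> 0"
    and int: "(\<lambda>i. Bochner_Integration.simple_bochner_integral M (s i)) \<longlonglongrightarrow> I"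
    unfolding has_bochner_int_def by blast
  show ?thesis
  proof (rule has_bochner_integral.intros)
    show "(\<lambda>x. inner c (f x)) \<in> borel_measurable M"
      by (rule borel_measurable_inner_const[OF f])
    show "Bochner_Integration.simple_bochner_integrable M (\<lambda>x. inner c (s i x))" for i
      using Bochner_Integration.simple_bochner_integrable_compose2[of "\<lambda>x y. inner c x", OF _ s s] by simp
    have linear: "linear (inner c)"
      by (simp add: bounded_linear.linear bounded_linear_inner_right)
    show "(\<lambda>i. Bochner_Integration.simple_bochner_integral M (\<lambda>x. inner c (s i x))) \<longlonglongrightarrow> inner c I"
      unfolding Bochner_Integration.simple_bochner_integral_linear[OF linear s]
      by (intro tendsto_intros int)
    have le: "(\<integral>\<^sup>+x. ennreal (norm (inner c (f x) - inner c (s i x))) \<partial>M)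
        \<le> ennreal (norm c) * (\<integral>\<^sup>+x. ennreal (norm (f x - s i x)) \<partial>M)" for i
    proof -
      have sf: "simple_function M (s i)"
        using s[of i] by (auto elim: Bochner_Integration.simple_bochner_integrable.cases)
      \<comment> \<open>Sorting by the finitely many values of \<open>s i\<close> leaves only
        distances from \<open>f x\<close> to fixed vectors, so the error is measurable and
        \<open>norm c\<close> can be pulled out of its integral.\<close>
      let ?g = "\<lambda>x. \<Sum>y\<in>s i ` space M. indicator (s i -` {y} \<inter> space M) x * norm (f x - y)"
      have "?g x = norm (f x - s i x)" if "x \<in> space M" for x
      proof -
        have "?g x = (\<Sum>y\<in>s i ` space M. if y = s i x then norm (f x - y) else 0)"
          using that by (intro sum.cong) (auto simp: indicator_def)
        then show ?thesis
          using that simple_functionD(1)[OF sf] by (simp add: sum.delta)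
      qed
      moreover have "?g \<in> borel_measurable M"
        using borel_measurable_norm_diff_const[OF f] simple_functionD(2)[OF sf]
        by (intro borel_measurable_sum borel_measurable_times borel_measurable_indicator) auto
      ultimately have meas: "(\<lambda>x. norm (f x - s i x)) \<in> borel_measurable M"
        by (rule measurable_cong[THEN iffD1])
      have "(\<integral>\<^sup>+x. ennreal (norm (inner c (f x) - inner c (s i x))) \<partial>M)
          \<le> (\<integral>\<^sup>+x. ennreal (norm c) * ennreal (norm (f x - s i x)) \<partial>M)"
        by (intro nn_integral_mono)
           (simp add: ennreal_mult'[symmetric] inner_diff_right[symmetric] Cauchy_Schwarz_ineq2 ennreal_leI)
      also have "\<dots> = ennreal (norm c) * (\<integral>\<^sup>+x. ennreal (norm (f x - s i x)) \<partial>M)"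
        using meas by (intro nn_integral_cmult) auto
      finally show ?thesis .
    qed
    show "(\<lambda>i. \<integral>\<^sup>+x. ennreal (norm (inner c (f x) - inner c (s i x))) \<partial>M) \<longlonglongrightarrow> 0"
    proof (rule tendsto_sandwich[OF _ _ tendsto_const])
      show "(\<lambda>i. ennreal (norm c) * (\<integral>\<^sup>+x. ennreal (norm (f x - s i x)) \<partial>M)) \<longlonglongrightarrow> 0"
        using ennreal_tendsto_cmult[OF _ lim, of "ennreal (norm c)"] by simp
    qed (use le in auto)
  qed
qed

text \<open>The distance from \<open>f x\<close> to the set of all values of the approximating
  simple functions is below every error \<open>norm (f x - s i x)\<close>, so its integral is
  zero.\<close>

lemma bochner_integrable_separably_valued:
  fixes f :: "'a \<Rightarrow> 'b::real_normed_vector"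
  assumes "bochner_integrable M f"
  shows "\<exists>D. countable D \<and> (AE x in M. f x \<in> closure D)"
proof -
  from assms obtain s where f: "f \<in> borel_measurable M"
    and s: "\<And>i. Bochner_Integration.simple_bochner_integrable M (s i)"
    and lim: "(\<lambda>i. \<integral>\<^sup>+x. ennreal (norm (f x - s i x)) \<partial>M) \<longlonglongrightarrow> 0"
    unfolding has_bochner_int_def bochner_integrable_def by blast
  \<comment> \<open>The point \<open>0\<close> keeps \<open>D\<close> nonempty even if
    \<open>space M\<close> is empty: \<open>infdist\<close> to the empty set is \<open>0\<close> by
    convention and would say nothing about the closure.\<close>
  define D where "D = insert 0 (\<Union>i. s i ` space M)"
  have "countable (s i ` space M)" for i
    using s[of i] by (auto simp: simple_function_def intro: countable_finite
        elim!: Bochner_Integration.simple_bochner_integrable.cases)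
  then have D: "countable D" by (simp add: D_def)
  have meas: "(\<lambda>x. infdist (f x) D) \<in> borel_measurable M"
    by (rule measurable_compose[OF f]) (intro borel_measurable_continuous_onI continuous_intros)
  have "(\<integral>\<^sup>+x. ennreal (infdist (f x) D) \<partial>M) \<le> (\<integral>\<^sup>+x. ennreal (norm (f x - s i x)) \<partial>M)" for i
    by (intro nn_integral_mono ennreal_leI) (auto simp: D_def simp flip: dist_norm intro!: infdist_le)
  then have "(\<integral>\<^sup>+x. ennreal (infdist (f x) D) \<partial>M) \<le> 0"
    using lim by (intro tendsto_lowerbound[OF lim]) auto
  then have "AE x in M. ennreal (infdist (f x) D) = 0"
    using meas by (subst (asm) le_zero_eq, subst (asm) nn_integral_0_iff_AE) auto
  then have "AE x in M. f x \<in> closure D"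
    by eventually_elim
       (auto simp: D_def infdist_nonneg ennreal_eq_0_iff in_closure_iff_infdist_zero intro!: antisym)
  with D show ?thesis by blast
qed

text \<open>Conditional expectation tested against fixed vectors. All conditions concern real
  functions, so real conditional expectations apply, and they survive changes on null sets.\<close>

definition weak_cond_exp ::
    "'a measure \<Rightarrow> 'a measure \<Rightarrow> ('a \<Rightarrow> 'h::real_inner) \<Rightarrow> ('a \<Rightarrow> 'h) \<Rightarrow> bool" where
  "weak_cond_exp M G g u \<longleftrightarrow>
     (\<forall>c. integrable M (\<lambda>x. inner c (g x)) \<and> integrable M (\<lambda>x. inner c (u x)) \<and>
       (\<forall>A\<in>sets G. (\<integral>x\<in>A. inner c (g x) \<partial>M) = (\<integral>x\<in>A. inner c (u x) \<partial>M)))"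

lemma is_cond_exp_imp_weak_cond_exp:
  fixes g u :: "'a \<Rightarrow> 'h::real_inner"
  assumes "is_cond_exp M G g u"
  shows "weak_cond_exp M G g u"
  unfolding weak_cond_exp_def
proof (intro allI conjI ballI)
  fix c
  show "integrable M (\<lambda>x. inner c (g x))" "integrable M (\<lambda>x. inner c (u x))"
    using assms unfolding is_cond_exp_def bochner_integrable_def
    by (auto dest!: has_bochner_int_inner[where c = c] simp: integrable.simps)
  fix A assume "A \<in> sets G"
  then obtain I where "has_bochner_int M (\<lambda>x. indicator A x *\<^sub>R g x) I"
    "has_bochner_int M (\<lambda>x. indicator A x *\<^sub>R u x) I"
    using assms unfolding is_cond_exp_def by blast
  then show "(\<integral>x\<in>A. inner c (g x) \<partial>M) = (\<integral>x\<in>A. inner c (u x) \<partial>M)"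
    unfolding set_lebesgue_integral_def
    by (auto dest!: has_bochner_int_inner[where c = c] has_bochner_integral_integral_eq)
qed

lemma weak_cond_exp_cong_AE:
  fixes g u g' u' :: "'a \<Rightarrow> 'h::real_inner"
  assumes weak: "weak_cond_exp M G g u" and sub: "subalgebra M G"
    and g': "g' \<in> borel_measurable M" and u': "u' \<in> borel_measurable M"
    and eq: "AE x in M. g x = g' x" "AE x in M. u x = u' x"
  shows "weak_cond_exp M G g' u'"
  unfolding weak_cond_exp_def
proof (intro allI conjI ballI)
  fix c
  have ig: "integrable M (\<lambda>x. inner c (g x))" and iu: "integrable M (\<lambda>x. inner c (u x))"
    using weak by (auto simp: weak_cond_exp_def)
  note meas = borel_measurable_integrable[OF ig] borel_measurable_integrable[OF iu]
    borel_measurable_inner_const[OF g', of c] borel_measurable_inner_const[OF u', of c]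
  have eqc: "AE x in M. inner c (g x) = inner c (g' x)" "AE x in M. inner c (u x) = inner c (u' x)"
    using eq by auto
  show "integrable M (\<lambda>x. inner c (g' x))" "integrable M (\<lambda>x. inner c (u' x))"
    using ig iu eqc meas integrable_cong_AE by blast+
  fix A assume A: "A \<in> sets G"
  then have "A \<in> sets M" using sub by (auto simp: subalgebra_def)
  then have "(\<integral>x\<in>A. inner c (g x) \<partial>M) = (\<integral>x\<in>A. inner c (g' x) \<partial>M)"
    "(\<integral>x\<in>A. inner c (u x) \<partial>M) = (\<integral>x\<in>A. inner c (u' x) \<partial>M)"
    unfolding set_lebesgue_integral_def using eqc meas by (auto intro!: integral_cong_AE)
  then show "(\<integral>x\<in>A. inner c (g' x) \<partial>M) = (\<integral>x\<in>A. inner c (u' x) \<partial>M)"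
    using weak A by (auto simp: weak_cond_exp_def)
qed

text \<open>For fixed \<open>c\<close>, \<open>inner c (u x)\<close> is the real conditional
  expectation of \<open>inner c (g x)\<close>, and the \<open>F\<close>-measurable factor
  \<open>\<psi>\<close> can be moved inside it.\<close>

lemma (in sigma_finite_subalgebra) weak_cond_exp_integral_mult:
  assumes weak: "weak_cond_exp M F g u"
    and u: "u \<in> borel_measurable F" and \<psi>: "\<psi> \<in> borel_measurable F"
    and int: "integrable M (\<lambda>x. \<psi> x * inner c (g x))"
  shows "(\<integral>x. \<psi> x * inner c (g x) \<partial>M) = (\<integral>x. \<psi> x * inner c (u x) \<partial>M)"
proof -
  have ig: "integrable M (\<lambda>x. inner c (g x))" and iu: "integrable M (\<lambda>x. inner c (u x))"
    using weak by (auto simp: weak_cond_exp_def)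
  have "AE x in M. real_cond_exp M F (\<lambda>x. inner c (g x)) x = inner c (u x)"
    using weak ig iu borel_measurable_inner_const[OF u]
    by (intro real_cond_exp_charact) (auto simp: weak_cond_exp_def)
  then have "(\<integral>x. \<psi> x * real_cond_exp M F (\<lambda>x. inner c (g x)) x \<partial>M) = (\<integral>x. \<psi> x * inner c (u x) \<partial>M)"
    using measurable_from_subalg[OF subalg \<psi>] borel_measurable_integrable[OF iu]
    by (intro integral_cong_AE) auto
  then show ?thesis
    using real_cond_exp_intg(2)[OF int \<psi> borel_measurable_integrable[OF ig]] by simp
qed

text \<open>
  The vector \<open>u x\<close> is replaced by the finitely valued \<open>nearest e (u x) m\<close>, whose norm is at most
  \<open>2 * norm (u x)\<close>, so that dominated convergence applies.
\<close>

lemma (in sigma_finite_subalgebra) weak_cond_exp_integral_inner: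
  fixes u g :: "'a \<Rightarrow> 'h::real_inner" and e :: "nat \<Rightarrow> 'h"
  assumes weak: "weak_cond_exp M F g u"
    and u: "u \<in> borel_measurable F" and g: "g \<in> borel_measurable M"
    and sep: "\<And>x. x \<in> space M \<Longrightarrow> u x \<in> closure (range e)"
    and \<phi>: "\<phi> \<in> borel_measurable F" and \<phi>_nonneg: "\<And>x. 0 \<le> \<phi> x"
    and int_g: "integrable M (\<lambda>x. \<phi> x * (norm (u x) * norm (g x)))"
    and int_u: "integrable M (\<lambda>x. \<phi> x * (norm (u x))\<^sup>2)"
  shows "integrable M (\<lambda>x. \<phi> x * inner (u x) (g x))"
    and "(\<integral>x. \<phi> x * inner (u x) (g x) \<partial>M) = (\<integral>x. \<phi> x * (norm (u x))\<^sup>2 \<partial>M)"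
proof -
  note uM = measurable_from_subalg[OF subalg u] and \<phi>M = measurable_from_subalg[OF subalg \<phi>]
  have FM: "A \<in> sets M" if "A \<in> sets F" for A
    using that subalg by (auto simp: subalgebra_def)
  have spF: "space F = space M" using subalg by (auto simp: subalgebra_def)
  have int_u': "integrable M (\<lambda>x. \<phi> x * (norm (u x) * norm (u x)))"
    using int_u by (simp add: power2_eq_square)
  have dom: "\<bar>indicator A x * \<phi> x * inner v h\<bar> \<le> 2 * (\<phi> x * (norm (u x) * norm h))"
    if "norm v \<le> 2 * norm (u x)" for A x v and h :: 'h
  proof -
    have "\<bar>inner v h\<bar> \<le> 2 * (norm (u x) * norm h)"
      using Cauchy_Schwarz_ineq2[of v h] mult_right_mono[OF that, of "norm h"] by simp
    from mult_left_mono[OF this \<phi>_nonneg[of x]] show ?thesis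
      using \<phi>_nonneg[of x] by (auto simp: indicator_def abs_mult)
  qed
  have int_nearest: "integrable M (\<lambda>x. indicator A x * \<phi> x * inner (nearest e (u x) m) (h x))"
    if "A \<in> sets F" "h \<in> borel_measurable M"
      "integrable M (\<lambda>x. \<phi> x * (norm (u x) * norm (h x)))" for A m and h :: "'a \<Rightarrow> 'h"
    using that FM[OF that(1)] \<phi>M borel_measurable_inner_nearest[OF uM that(2)] dom[OF norm_nearest_le]
      \<phi>_nonneg
    by (intro Bochner_Integration.integrable_bound[OF integrable_mult_right[OF that(3), of 2]])
       (auto simp: abs_mult)
  \<comment> \<open>The induction keeps \<open>A\<close> arbitrary because the switching set
    \<open>B\<close> of the last comparison splits it into \<open>A \<inter> B\<close> and
    \<open>A - B\<close>.\<close>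
  have step: "(\<integral>x. indicator A x * \<phi> x * inner (nearest e (u x) m) (g x) \<partial>M)
      = (\<integral>x. indicator A x * \<phi> x * inner (nearest e (u x) m) (u x) \<partial>M)" if "A \<in> sets F" for A m
    using that
  proof (induction m arbitrary: A)
    case 0
    then show ?case by simp
  next
    case (Suc m)
    define B where "B = {x \<in> space F. norm (u x - e m) < norm (u x - nearest e (u x) m)}"
    have B: "B \<in> sets F" unfolding B_def by (rule nearest_switch_sets[OF u])
    then have AB: "A \<inter> B \<in> sets F" "A - B \<in> sets F" using Suc.prems by auto
    \<comment> \<open>On \<open>B\<close> the vector \<open>e m\<close> equals
      \<open>nearest e (u x) (Suc m)\<close>. The bound, and with it integrability, is available
      only there.\<close>
    have e_le: "norm (e m) \<le> 2 * norm (u x)" if "x \<in> B" for x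
      using norm_nearest_le[of e "u x" "Suc m"] that by (auto simp: B_def)
    have int_e: "integrable M (\<lambda>x. indicator (A \<inter> B) x * \<phi> x * inner (e m) (h x))"
      if h: "h \<in> borel_measurable M" "integrable M (\<lambda>x. \<phi> x * (norm (u x) * norm (h x)))"
      for h :: "'a \<Rightarrow> 'h"
    proof (rule Bochner_Integration.integrable_bound[OF integrable_mult_right[OF h(2), of 2]])
      show "(\<lambda>x. indicator (A \<inter> B) x * \<phi> x * inner (e m) (h x)) \<in> borel_measurable M"
        using FM[OF AB(1)] \<phi>M borel_measurable_inner_const[OF h(1)] by measurable
      show "AE x in M. norm (indicator (A \<inter> B) x * \<phi> x * inner (e m) (h x))
          \<le> norm (2 * (\<phi> x * (norm (u x) * norm (h x))))"
      proof (rule AE_I2)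
        fix x
        show "norm (indicator (A \<inter> B) x * \<phi> x * inner (e m) (h x))
          \<le> norm (2 * (\<phi> x * (norm (u x) * norm (h x))))"
          using dom[OF e_le, of x "A \<inter> B" "h x"] \<phi>_nonneg[of x]
          by (cases "x \<in> B") (auto simp: abs_mult)
      qed
    qed
    have split: "(\<integral>x. indicator A x * \<phi> x * inner (nearest e (u x) (Suc m)) (h x) \<partial>M)
        = (\<integral>x. indicator (A \<inter> B) x * \<phi> x * inner (e m) (h x) \<partial>M)
        + (\<integral>x. indicator (A - B) x * \<phi> x * inner (nearest e (u x) m) (h x) \<partial>M)"
      if h: "h \<in> borel_measurable M" "integrable M (\<lambda>x. \<phi> x * (norm (u x) * norm (h x)))"
      for h :: "'a \<Rightarrow> 'h"
      unfolding Bochner_Integration.integral_add[OF int_e[OF h] int_nearest[OF AB(2) h], symmetric]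
      by (intro Bochner_Integration.integral_cong) (auto simp: B_def indicator_def spF)
    have "(\<lambda>x. indicator (A \<inter> B) x * \<phi> x) \<in> borel_measurable F"
      using AB \<phi> by measurable
    from weak_cond_exp_integral_mult[OF weak u this int_e[OF g int_g]] Suc.IH[OF AB(2)]
    show ?case
      unfolding split[OF g int_g] split[OF uM int_u'] by simp
  qed
  have limit: "integrable M (\<lambda>x. \<phi> x * inner (u x) (h x)) \<and>
      (\<lambda>m. \<integral>x. indicator (space M) x * \<phi> x * inner (nearest e (u x) m) (h x) \<partial>M)
        \<longlonglongrightarrow> (\<integral>x. \<phi> x * inner (u x) (h x) \<partial>M)"
    if h: "h \<in> borel_measurable M" "integrable M (\<lambda>x. \<phi> x * (norm (u x) * norm (h x)))"
    for h :: "'a \<Rightarrow> 'h"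
  proof -
    have meas: "(\<lambda>x. \<phi> x * inner (u x) (h x)) \<in> borel_measurable M"
      using \<phi>M borel_measurable_inner_separable[OF uM h(1) sep] by measurable
    have meas_nearest: "(\<lambda>x. indicator (space M) x * \<phi> x * inner (nearest e (u x) m) (h x)) \<in> borel_measurable M" for m
      using \<phi>M borel_measurable_inner_nearest[OF uM h(1)] by measurable
    have lim: "AE x in M. (\<lambda>m. indicator (space M) x * \<phi> x * inner (nearest e (u x) m) (h x))
        \<longlonglongrightarrow> \<phi> x * inner (u x) (h x)"
      by (rule AE_I2) (auto intro!: tendsto_intros nearest_tendsto sep)
    note bound = integrable_mult_right[OF h(2), of 2]
    have le: "AE x in M. norm (indicator (space M) x * \<phi> x * inner (nearest e (u x) m) (h x))
        \<le> 2 * (\<phi> x * (norm (u x) * norm (h x)))" for m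
      by (intro AE_I2) (simp only: real_norm_def, rule dom[OF norm_nearest_le])
    show ?thesis
      using integrable_dominated_convergence[OF meas meas_nearest bound lim le]
        integral_dominated_convergence[OF meas meas_nearest bound lim le] by simp
  qed
  have "space M \<in> sets F" using spF by (metis sets.top)
  from step[OF this] limit[OF g int_g] limit[OF uM int_u']
  show "integrable M (\<lambda>x. \<phi> x * inner (u x) (g x))"
    and "(\<integral>x. \<phi> x * inner (u x) (g x) \<partial>M) = (\<integral>x. \<phi> x * (norm (u x))\<^sup>2 \<partial>M)"
    by (auto simp: power2_norm_eq_inner intro: LIMSEQ_unique)
qed

section \<open>Running maxima\<close>

primrec runmax :: "(nat \<Rightarrow> 'a \<Rightarrow> real) \<Rightarrow> nat \<Rightarrow> 'a \<Rightarrow> real" where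
  "runmax g 0 = g 0"
| "runmax g (Suc n) = (\<lambda>x. max (runmax g n x) (g (Suc n) x))"

lemma runmax_ge: "g n x \<le> runmax g n x"
  by (cases n) auto

lemma runmax_mono: "m \<le> n \<Longrightarrow> runmax g m x \<le> runmax g n x"
  by (rule lift_Suc_mono_le) auto

lemma runmax_attained: "\<exists>k\<le>n. runmax g n x = g k x"
  by (induction n) (auto simp: max_def le_Suc_eq)

lemma runmax_adapted:
  assumes "filtration \<Omega> F" "\<And>n. g n \<in> borel_measurable (F n)"
  shows "runmax g n \<in> borel_measurable (F n)"
proof (induction n)
  case (Suc n)
  have "subalgebra (F (Suc n)) (F n)"
    using assms(1) filtration.sets_F_mono[of \<Omega> F n "Suc n"] by (simp add: subalgebra_def filtration.space_F)
  from measurable_from_subalg[OF this Suc] assms(2)[of "Suc n"] show ?case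
    by simp
qed (simp add: assms)

section \<open>Powers and Hoelder's inequality\<close>

lemma ennreal_pow_ennreal: "0 \<le> a \<Longrightarrow> p \<noteq> 0 \<Longrightarrow> ennreal_pow (ennreal a) p = ennreal (a powr p)"
  by (simp add: ennreal_pow_def)

lemma ennreal_pow_mono:
  assumes "a \<le> b" "0 \<le> p"
  shows "ennreal_pow a p \<le> ennreal_pow b p"
  using assms
  by (cases a; cases b) (auto simp: ennreal_pow_def top_unique intro!: ennreal_leI powr_mono2)

lemma ennreal_pow_mult_ennreal:
  assumes "0 \<le> c" "0 < p"
  shows "ennreal_pow (ennreal c * a) p \<le> ennreal (c powr p) * ennreal_pow a p"
proof (cases a)
  case (real x)
  then show ?thesis
    using assms by (simp add: ennreal_mult[symmetric] ennreal_pow_ennreal powr_mult)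
next
  case top
  then show ?thesis
    using assms by (cases "c = 0") (auto simp: ennreal_pow_def ennreal_mult_eq_top_iff ennreal_mult_top)
qed

lemma ennreal_pow_pos: "0 < a \<Longrightarrow> 0 < ennreal_pow a p"
  by (cases a) (auto simp: ennreal_pow_def)

text \<open>For finite positive integrals this is Young's inequality for
  \<open>X x / \<alpha>\<close> and \<open>Y x / \<beta>\<close>, scaled by \<open>?c\<close> and
  integrated. The case \<open>p = 1\<close> is separate, since there the second factor on the right
  is \<open>1\<close> by convention.\<close>

lemma nn_integral_powr_Hoelder:
  fixes X Y :: "'a \<Rightarrow> real"
  assumes X: "X \<in> borel_measurable M" and Y: "Y \<in> borel_measurable M"
    and nonneg: "\<And>x. 0 \<le> X x" "\<And>x. 0 \<le> Y x" and p: "0 < p" "p \<le> 1"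
  shows "(\<integral>\<^sup>+x. ennreal (X x powr p * Y x powr (1 - p)) \<partial>M)
    \<le> ennreal_pow (\<integral>\<^sup>+x. ennreal (X x) \<partial>M) p * ennreal_pow (\<integral>\<^sup>+x. ennreal (Y x) \<partial>M) (1 - p)"
    (is "?L \<le> ennreal_pow ?a p * ennreal_pow ?b (1 - p)")
proof (cases "p = 1")
  case True
  have "?L \<le> ?a"
    using True nonneg by (intro nn_integral_mono ennreal_leI) auto
  then show ?thesis
    using True by (cases ?a) (auto simp: ennreal_pow_def top_unique)
next
  case False
  with p have p: "0 < p" "p < 1" by auto
  \<comment> \<open>If an integral vanishes, the left side does too; if neither does and one is
    infinite, the right side is infinite.\<close>
  consider "?a = 0 \<or> ?b = 0" | "?a \<noteq> 0" "?b \<noteq> 0" "?a = \<infinity> \<or> ?b = \<infinity>"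
    | \<alpha> \<beta> where "?a = ennreal \<alpha>" "?b = ennreal \<beta>" "0 < \<alpha>" "0 < \<beta>"
    by (cases ?a; cases ?b) (auto simp: less_le)
  then show ?thesis
  proof cases
    case 1
    have "AE x in M. ennreal (X x powr p * Y x powr (1 - p)) = 0"
    proof (cases "?a = 0")
      case True
      then have "AE x in M. ennreal (X x) = 0" using X by (subst (asm) nn_integral_0_iff_AE) auto
      then show ?thesis
      proof eventually_elim
        case (elim x)
        then have "X x = 0" using nonneg(1)[of x] by (simp add: ennreal_eq_0_iff)
        then show ?case by simp
      qed
    next
      case False
      then have "AE x in M. ennreal (Y x) = 0" using Y 1 by (subst (asm) nn_integral_0_iff_AE) auto
      then show ?thesis
      proof eventually_elim
        case (elim x)
        then have "Y x = 0" using nonneg(2)[of x] by (simp add: ennreal_eq_0_iff)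
        then show ?case by simp
      qed
    qed
    then have "?L = 0" using X Y by (subst nn_integral_0_iff_AE) auto
    then show ?thesis by simp
  next
    case 2
    then have "ennreal_pow ?a p * ennreal_pow ?b (1 - p) = \<infinity>"
      using p ennreal_pow_pos[of ?a p] ennreal_pow_pos[of ?b "1 - p"]
      by (auto simp: ennreal_pow_def ennreal_mult_eq_top_iff zero_less_iff_neq_zero)
    then show ?thesis by simp
  next
    case 3
    let ?c = "\<alpha> powr p * \<beta> powr (1 - p)"
    have young: "X x powr p * Y x powr (1 - p) \<le> ?c * p / \<alpha> * X x + ?c * (1 - p) / \<beta> * Y x" for x
    proof (cases "X x = 0 \<or> Y x = 0")
      case True
      then show ?thesis using nonneg[of x] p 3 by auto
    next
      case False
      then have pos: "0 < X x" "0 < Y x" using nonneg[of x] by auto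
      have "(X x / \<alpha>) powr p * (Y x / \<beta>) powr (1 - p) \<le> p * (X x / \<alpha>) + (1 - p) * (Y x / \<beta>)"
        using p pos 3 by (intro Youngs_inequality_0) auto
      from mult_left_mono[OF this, of ?c] show ?thesis
        using p pos 3 by (simp add: powr_divide algebra_simps)
    qed
    have "?L \<le> (\<integral>\<^sup>+x. ennreal (?c * p / \<alpha>) * ennreal (X x) + ennreal (?c * (1 - p) / \<beta>) * ennreal (Y x) \<partial>M)"
      using young nonneg p 3
      by (intro nn_integral_mono) (simp add: ennreal_mult[symmetric] ennreal_plus[symmetric] ennreal_leI del: ennreal_plus)
    also have "\<dots> = ennreal (?c * p / \<alpha>) * ?a + ennreal (?c * (1 - p) / \<beta>) * ?b"
      using X Y by (subst nn_integral_add) (auto simp: nn_integral_cmult)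
    also have "\<dots> = ennreal (?c * p / \<alpha> * \<alpha> + ?c * (1 - p) / \<beta> * \<beta>)"
      using 3 p by (simp add: ennreal_mult[symmetric] ennreal_plus[symmetric] del: ennreal_plus)
    also have "\<dots> = ennreal ?c"
      using 3 by (simp flip: distrib_left)
    also have "\<dots> = ennreal_pow ?a p * ennreal_pow ?b (1 - p)"
      using 3 p by (simp add: ennreal_pow_ennreal ennreal_mult)
    finally show ?thesis .
  qed
qed

section \<open>The weighted square function inequality\<close>

text \<open>With \<open>q\<close> as in the proof the claim becomes
  \<open>v * (3 * y + q / y) \<le> v' * (3 * y' + q / y')\<close>. Replacing \<open>y\<close> by
  \<open>y'\<close> is allowed as \<open>q \<le> 2 * (y * y')\<close>, then \<open>v\<close> by
  \<open>v'\<close> as \<open>3 * y' + q / y'\<close> is nonnegative. The latter needs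
  \<open>q \<ge> - 3 * y'\<^sup>2\<close>, whence the constant 3.\<close>

lemma square_increment_step:
  fixes x x' :: "'h::real_inner" and v v' y y' :: real
  assumes "norm x \<le> y" "y' = max y (norm x')" "0 \<le> v" "v \<le> v'"
  shows "v' * (norm (x' - x))\<^sup>2 / y' \<le>
    v' * (3 * y' + (norm x')\<^sup>2 / y') - v * (3 * y + (norm x)\<^sup>2 / y) - 2 * (v / y) * inner x (x' - x)"
proof (cases "y = 0")
  \<comment> \<open>Quotients by \<open>y\<close> are \<open>0\<close> by convention and
    \<open>x\<close> is zero, so the left side is one of the terms on the right.\<close>
  case True
  then show ?thesis using assms by (simp add: algebra_simps)
next
  case False
  with assms(1) have y: "0 < y" by (smt (verit) norm_ge_zero)
  have y': "y \<le> y'" "norm x' \<le> y'" using assms by auto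
  \<comment> \<open>The linearisation at \<open>x\<close> of the squared norm, evaluated at
    \<open>x'\<close>; it falls short of \<open>(norm x')\<^sup>2\<close> by exactly
    \<open>(norm (x' - x))\<^sup>2\<close>.\<close>
  define q where "q = 2 * inner x x' - (norm x)\<^sup>2"
  have cs: "\<bar>inner x x'\<bar> \<le> y * y'"
    using Cauchy_Schwarz_ineq2[of x x'] mult_mono[OF assms(1) y'(2)] y by (smt (verit) norm_ge_zero)
  have q_le: "q \<le> 2 * (y * y')" using cs unfolding q_def by (smt (verit) zero_le_power2)
  have "(norm x)\<^sup>2 \<le> y'\<^sup>2" using assms(1) y' by (intro power_mono) auto
  moreover have "y * y' \<le> y'\<^sup>2" using y y' by (simp add: power2_eq_square mult_right_mono)
  ultimately have q_ge: "- 3 * y'\<^sup>2 \<le> q" using cs unfolding q_def by linarith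
  have "0 \<le> 3 * y' + q / y'"
    using q_ge y y' by (simp add: field_simps power2_eq_square)
  then have "v * (3 * y' + q / y') \<le> v' * (3 * y' + q / y')"
    using assms by (intro mult_right_mono)
  moreover have "3 * y + q / y \<le> 3 * y' + q / y'"
  proof -
    have "0 \<le> y * y'" using y y' by simp
    then have "(y' - y) * q \<le> (y' - y) * (3 * (y * y'))"
      using q_le y' by (intro mult_left_mono) auto
    then show ?thesis using y y' by (simp add: field_simps)
  qed
  then have "v * (3 * y + q / y) \<le> v * (3 * y' + q / y')"
    using assms by (intro mult_left_mono)
  ultimately have *: "v * (3 * y + q / y) \<le> v' * (3 * y' + q / y')" by linarith
  have d: "(norm (x' - x))\<^sup>2 = (norm x')\<^sup>2 - q"
    by (simp add: q_def power2_norm_eq_inner inner_diff inner_commute)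
  have s: "inner x (x' - x) = (q - (norm x)\<^sup>2) / 2"
    by (simp add: q_def power2_norm_eq_inner inner_diff)
  have e: "v' * ((norm x')\<^sup>2 - q) / y' = v' * (3 * y' + (norm x')\<^sup>2 / y') - v' * (3 * y' + q / y')"
    "2 * (v / y) * ((q - (norm x)\<^sup>2) / 2) = v * (3 * y + q / y) - v * (3 * y + (norm x)\<^sup>2 / y)"
    by (simp_all add: algebra_simps diff_divide_distrib)
  show ?thesis
    unfolding d s e using * by linarith
qed

text \<open>The situation after the change on a null set: values lie in a separable closed set at
  every point, and the martingale property is used one step at a time through scalar
  products.\<close>

locale separable_weak_martingale = finite_measure M for M :: "'a measure" +
  fixes F :: "nat \<Rightarrow> 'a measure" and f :: "nat \<Rightarrow> 'a \<Rightarrow> 'h::real_inner" and e :: "nat \<Rightarrow> 'h"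
  assumes filtration: "filtration (space M) F"
    and subalgebra: "subalgebra M (F n)"
    and adapted: "f n \<in> borel_measurable (F n)"
    and separable: "x \<in> space M \<Longrightarrow> f n x \<in> closure (range e)"
    and weak_cond_exp: "weak_cond_exp M (F n) (f (Suc n)) (f n)"
begin

definition Y :: "nat \<Rightarrow> 'a \<Rightarrow> real" where
  "Y = runmax (\<lambda>n x. norm (f n x))"

lemma norm_le_Y: "norm (f n x) \<le> Y n x"
  unfolding Y_def using runmax_ge[of "\<lambda>n x. norm (f n x)"] .

lemma Y_nonneg: "0 \<le> Y n x"
  using norm_le_Y[of n x] norm_ge_zero order_trans by blast

lemma Y_mono: "m \<le> n \<Longrightarrow> Y m x \<le> Y n x"
  unfolding Y_def by (rule runmax_mono)

lemma Y_Suc: "Y (Suc n) x = max (Y n x) (norm (f (Suc n) x))"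
  by (simp add: Y_def)

lemma Y_adapted: "Y n \<in> borel_measurable (F n)"
  unfolding Y_def using borel_measurable_norm_diff_const[OF adapted, of _ 0]
  by (intro runmax_adapted[OF filtration]) simp

lemma from_F: "g \<in> borel_measurable (F n) \<Longrightarrow> g \<in> borel_measurable M"
  by (rule measurable_from_subalg[OF subalgebra])

lemma space_F: "space (F n) = space M"
  using subalgebra[of n] by (simp add: subalgebra_def)

lemma from_F_Suc: "g \<in> borel_measurable (F n) \<Longrightarrow> g \<in> borel_measurable (F (Suc n))"
  using filtration.sets_F_mono[OF filtration, of n "Suc n"]
  by (intro measurable_from_subalg[of "F (Suc n)" "F n"]) (simp_all add: subalgebra_def space_F)

lemma norm_increment_adapted: "(\<lambda>x. norm (f (Suc n) x - f n x)) \<in> borel_measurable (F (Suc n))"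
  using separable by (intro borel_measurable_norm_diff_separable[where e = e] from_F_Suc adapted) (simp add: space_F)

lemma norm_increment_le: "norm (f (Suc n) x - f n x) \<le> 2 * Y (Suc n) x"
  using norm_triangle_ineq4[of "f (Suc n) x" "f n x"] norm_le_Y[of "Suc n" x] norm_le_Y[of n x]
    Y_mono[of n "Suc n" x] by simp

text \<open>Summing \<open>square_increment_step\<close> telescopes the potential, up to terms
  \<open>T n\<close> of mean zero. If the right side is finite, \<open>V N * Y N\<close> is
  integrable and dominates everything else.\<close>

lemma weighted_square_sum_le:
  assumes V_adapted: "\<And>n. V n \<in> borel_measurable (F n)"
    and V_nonneg: "\<And>n x. 0 \<le> V n x" and V_Suc: "\<And>n x. V n x \<le> V (Suc n) x"
  shows "(\<integral>\<^sup>+x. ennreal (\<Sum>n<N. V (Suc n) x * (norm (f (Suc n) x - f n x))\<^sup>2 / Y (Suc n) x) \<partial>M)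
    \<le> 4 * (\<integral>\<^sup>+x. ennreal (V N x * Y N x) \<partial>M)"
proof (cases "(\<integral>\<^sup>+x. ennreal (V N x * Y N x) \<partial>M) = \<infinity>")
  case True
  then show ?thesis by (simp add: ennreal_mult_top)
next
  case False
  have VM: "V n \<in> borel_measurable M" and YM: "Y n \<in> borel_measurable M"
    and fM: "f n \<in> borel_measurable M" for n
    using V_adapted Y_adapted adapted from_F by blast+
  have normM: "(\<lambda>x. norm (f n x)) \<in> borel_measurable M" for n
    using borel_measurable_norm_diff_const[OF fM, of _ 0] by simp
  have V_mono: "V m x \<le> V n x" if "m \<le> n" for m n x
    using V_Suc that by (rule lift_Suc_mono_le)
  have VY_nonneg: "0 \<le> V N x * Y N x" for x
    using V_nonneg Y_nonneg by simp
  have int_VY: "integrable M (\<lambda>x. V N x * Y N x)"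
    using False VM YM VY_nonneg by (intro integrableI_nonneg) (auto simp: top.not_eq_extremum)
  define \<phi> where "\<phi> = (\<lambda>n x. 2 * (V n x / Y n x))"
  have \<phi>_nonneg: "0 \<le> \<phi> n x" for n x
    unfolding \<phi>_def using V_nonneg Y_nonneg by simp
  have \<phi>F: "\<phi> n \<in> borel_measurable (F n)" for n
    unfolding \<phi>_def using V_adapted Y_adapted by measurable
  \<comment> \<open>The quotient of \<open>norm (f n x)\<close> by \<open>Y n x\<close> is at most
    1, also in the degenerate case \<open>Y n x = 0\<close>, so the division in
    \<open>\<phi>\<close> does no harm to integrability.\<close>
  have bound: "\<phi> n x * (norm (f n x) * b) \<le> 2 * (V N x * Y N x)"
    if "n \<le> N" "0 \<le> b" "b \<le> Y N x" for n x b
  proof -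
    have "\<phi> n x * norm (f n x) \<le> 2 * V N x"
    proof (cases "Y n x = 0")
      case False
      then have "norm (f n x) / Y n x \<le> 1" using norm_le_Y[of n x] Y_nonneg[of n x] by simp
      then have "V n x * (norm (f n x) / Y n x) \<le> V n x * 1"
        using V_nonneg by (rule mult_left_mono)
      then show ?thesis using V_mono[OF that(1), of x] by (simp add: \<phi>_def)
    qed (simp add: \<phi>_def V_nonneg)
    from mult_mono[OF this that(3)] show ?thesis
      using that V_nonneg by (simp add: mult.assoc)
  qed
  have int: "integrable M (\<lambda>x. \<phi> n x * (norm (f n x) * norm (f k x)))" if "n \<le> N" "k \<le> N" for n k
    using bound[OF that(1) norm_ge_zero order_trans[OF norm_le_Y Y_mono[OF that(2)]]] \<phi>_nonneg V_nonneg Y_nonneg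
      from_F[OF \<phi>F] normM
    by (intro Bochner_Integration.integrable_bound[OF integrable_mult_right[OF int_VY, of 2]])
       (auto simp: abs_mult)
  \<comment> \<open>This is \<open>\<phi> n x * inner (f n x) (f (Suc n) x - f n x)\<close>,
    expanded into the two integrands of \<open>weak_cond_exp_integral_inner\<close>.\<close>
  define T where "T = (\<lambda>n x. \<phi> n x * inner (f n x) (f (Suc n) x) - \<phi> n x * (norm (f n x))\<^sup>2)"
  have T: "integrable M (T n) \<and> (\<integral>x. T n x \<partial>M) = 0" if "n < N" for n
  proof -
    interpret sub: finite_measure_subalgebra M "F n"
      using subalgebra by unfold_locales
    have int_u: "integrable M (\<lambda>x. \<phi> n x * (norm (f n x))\<^sup>2)"
      using int[of n n] that by (simp add: power2_eq_square)
    have int_g: "integrable M (\<lambda>x. \<phi> n x * (norm (f n x) * norm (f (Suc n) x)))"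
      using int[of n "Suc n"] that by simp
    note * = sub.weak_cond_exp_integral_inner[OF weak_cond_exp adapted fM separable \<phi>F \<phi>_nonneg int_g int_u]
    show ?thesis
      unfolding T_def using * int_u by simp
  qed
  have int_T: "integrable M (\<lambda>x. \<Sum>n<N. T n x)"
    using T by (intro Bochner_Integration.integrable_sum) simp
  have le: "(\<Sum>n<k. V (Suc n) x * (norm (f (Suc n) x - f n x))\<^sup>2 / Y (Suc n) x)
      \<le> V k x * (3 * Y k x + (norm (f k x))\<^sup>2 / Y k x) - (\<Sum>n<k. T n x)" for k x
  proof (induction k)
    case 0
    then show ?case using V_nonneg Y_nonneg by simp
  next
    case (Suc k)
    have "2 * (V k x / Y k x) * inner (f k x) (f (Suc k) x - f k x) = T k x"
      by (simp add: T_def \<phi>_def inner_diff_right power2_norm_eq_inner right_diff_distrib)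
    then show ?case
      using square_increment_step[OF norm_le_Y[of k x] Y_Suc[of k x] V_nonneg[of k x] V_Suc[of k x]] Suc by simp
  qed
  have le4: "(\<Sum>n<N. V (Suc n) x * (norm (f (Suc n) x - f n x))\<^sup>2 / Y (Suc n) x)
      \<le> 4 * (V N x * Y N x) - (\<Sum>n<N. T n x)" for x
  proof -
    \<comment> \<open>The quotient adds one more \<open>Y N x\<close> to the three already present,
      which gives the constant 4.\<close>
    have "(norm (f N x))\<^sup>2 / Y N x \<le> Y N x"
      using norm_le_Y[of N x] Y_nonneg[of N x] power_mono[OF norm_le_Y[of N x], of 2]
      by (cases "Y N x = 0") (auto simp: field_simps power2_eq_square)
    then have "V N x * (3 * Y N x + (norm (f N x))\<^sup>2 / Y N x) \<le> V N x * (4 * Y N x)"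
      using V_nonneg by (intro mult_left_mono) auto
    with le[where k = N and x = x] show ?thesis by simp
  qed
  have nonneg: "0 \<le> 4 * (V N x * Y N x) - (\<Sum>n<N. T n x)" for x
    using V_nonneg Y_nonneg by (intro order_trans[OF _ le4] sum_nonneg) auto
  have "(\<integral>\<^sup>+x. ennreal (\<Sum>n<N. V (Suc n) x * (norm (f (Suc n) x - f n x))\<^sup>2 / Y (Suc n) x) \<partial>M)
      \<le> (\<integral>\<^sup>+x. ennreal (4 * (V N x * Y N x) - (\<Sum>n<N. T n x)) \<partial>M)"
    by (intro nn_integral_mono ennreal_leI le4)
  also have "\<dots> = ennreal (\<integral>x. 4 * (V N x * Y N x) - (\<Sum>n<N. T n x) \<partial>M)"
    using int_VY int_T nonneg by (intro nn_integral_eq_integral) auto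
  also have "(\<integral>x. 4 * (V N x * Y N x) - (\<Sum>n<N. T n x) \<partial>M) = 4 * (\<integral>x. V N x * Y N x \<partial>M)"
    using int_VY int_T T by (simp add: Bochner_Integration.integral_diff Bochner_Integration.integral_sum)
  also have "ennreal \<dots> = 4 * (\<integral>\<^sup>+x. ennreal (V N x * Y N x) \<partial>M)"
    using int_VY VY_nonneg by (simp add: nn_integral_eq_integral ennreal_mult)
  finally show ?thesis .
qed

text \<open>Hoelder's inequality leaves the mean of \<open>A x * w x\<close>, where \<open>w\<close>
  is replaced by \<open>W (Suc n)\<close> term by term. Assumption \<open>W_dom\<close> expresses
  that \<open>W n\<close> dominates the conditional expectation of \<open>w\<close> given
  \<open>F n\<close>.\<close>

lemma square_function_weighted_le:
  assumes r: "1 \<le> r" "r \<le> 2"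
    and w: "w \<in> borel_measurable M" "\<And>x. x \<in> space M \<Longrightarrow> 0 < w x"
    and W_adapted: "\<And>n. W n \<in> borel_measurable (F n)"
    and W_nonneg: "\<And>n x. 0 \<le> W n x" and W_Suc: "\<And>n x. W n x \<le> W (Suc n) x"
    and W_dom: "\<And>n g. g \<in> borel_measurable (F n) \<Longrightarrow>
      (\<integral>\<^sup>+x. g x * ennreal (w x) \<partial>M) \<le> (\<integral>\<^sup>+x. g x * ennreal (W n x) \<partial>M)"
  shows "(\<integral>\<^sup>+x. ennreal (sqrt (\<Sum>n<N. (norm (f (Suc n) x - f n x))\<^sup>2) powr r) * ennreal (w x) \<partial>M)
    \<le> ennreal (2 powr r)
      * ennreal_pow (\<integral>\<^sup>+x. ennreal (Y N x powr r) * ennreal (w x) \<partial>M) (1 - r / 2)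
      * ennreal_pow (\<integral>\<^sup>+x. ennreal (Y N x powr r) * ennreal (W N x) \<partial>M) (r / 2)"
proof -
  define d where "d = (\<lambda>n x. (norm (f (Suc n) x - f n x))\<^sup>2)"
  \<comment> \<open>Where \<open>Y (Suc n) x = 0\<close>, the negative power is \<open>0\<close> by
    convention; the increment vanishes there as well, so nothing is lost.\<close>
  define a where "a = (\<lambda>n x. d n x * Y (Suc n) x powr (r - 2))"
  define A where "A = (\<lambda>x. \<Sum>n<N. a n x)"
  have d_nonneg: "0 \<le> d n x" for n x by (simp add: d_def)
  have a_nonneg: "0 \<le> a n x" for n x using d_nonneg by (simp add: a_def)
  then have A_nonneg: "0 \<le> A x" for x by (simp add: A_def sum_nonneg)
  have aF: "a n \<in> borel_measurable (F (Suc n))" for n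
    unfolding a_def d_def using norm_increment_adapted Y_adapted by measurable
  have aM: "a n \<in> borel_measurable M" for n using aF from_F by blast
  then have AM: "A \<in> borel_measurable M" unfolding A_def by measurable
  have YM: "Y n \<in> borel_measurable M" and WM: "W n \<in> borel_measurable M" for n
    using Y_adapted W_adapted from_F by blast+
  have Y0: "d n x = 0" if "Y (Suc n) x = 0" for n x
    using norm_increment_le[of n x] that by (simp add: d_def)

  have sum_le: "(\<Sum>n<N. d n x) \<le> A x * Y N x powr (2 - r)" for x
    unfolding A_def sum_distrib_right
  proof (rule sum_mono)
    fix n assume "n \<in> {..<N}"
    then have Yle: "Y (Suc n) x \<le> Y N x" by (intro Y_mono) auto
    show "d n x \<le> a n x * Y N x powr (2 - r)"
    proof (cases "Y (Suc n) x = 0")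
      case True
      then show ?thesis using Y0 a_nonneg by simp
    next
      case False
      then have pos: "0 < Y (Suc n) x" using Y_nonneg[of "Suc n" x] by simp
      have "1 = Y (Suc n) x powr (r - 2) * Y (Suc n) x powr (2 - r)"
        using pos by (simp flip: powr_add)
      also have "\<dots> \<le> Y (Suc n) x powr (r - 2) * Y N x powr (2 - r)"
        using pos Yle r by (intro mult_left_mono powr_mono2) auto
      finally have "d n x * 1 \<le> d n x * (Y (Suc n) x powr (r - 2) * Y N x powr (2 - r))"
        using d_nonneg by (intro mult_left_mono) auto
      then show ?thesis by (simp add: a_def mult.assoc)
    qed
  qed
  \<comment> \<open>The weight is split as \<open>w x powr (r / 2) * w x powr (1 - r / 2)\<close>,
    one part for each Hoelder factor.\<close>
  have pointwise: "sqrt (\<Sum>n<N. d n x) powr r * w x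
      \<le> (A x * w x) powr (r / 2) * (Y N x powr r * w x) powr (1 - r / 2)" if "x \<in> space M" for x
  proof -
    have S: "0 \<le> (\<Sum>n<N. d n x)" by (intro sum_nonneg d_nonneg)
    have "sqrt (\<Sum>n<N. d n x) powr r = (\<Sum>n<N. d n x) powr (r / 2)"
      using S by (simp add: powr_half_sqrt[symmetric] powr_powr)
    also have "\<dots> \<le> (A x * Y N x powr (2 - r)) powr (r / 2)"
      using sum_le S r by (intro powr_mono2) auto
    also have "\<dots> = A x powr (r / 2) * (Y N x powr r) powr (1 - r / 2)"
    proof -
      have "(Y N x powr (2 - r)) powr (r / 2) = (Y N x powr r) powr (1 - r / 2)"
        unfolding powr_powr by (rule arg_cong[where f = "\<lambda>z. Y N x powr z"]) (simp add: field_simps)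
      then show ?thesis using A_nonneg by (simp add: powr_mult)
    qed
    finally have "sqrt (\<Sum>n<N. d n x) powr r * w x
        \<le> A x powr (r / 2) * (Y N x powr r) powr (1 - r / 2) * w x"
      using w(2)[OF that] by (intro mult_right_mono) auto
    also have "\<dots> = A x powr (r / 2) * (Y N x powr r) powr (1 - r / 2)
        * (w x powr (r / 2) * w x powr (1 - r / 2))"
      using w(2)[OF that] by (simp flip: powr_add)
    also have "\<dots> = (A x * w x) powr (r / 2) * (Y N x powr r * w x) powr (1 - r / 2)"
      using A_nonneg w(2)[OF that] by (simp add: powr_mult mult_ac)
    finally show ?thesis .
  qed

  have A_le: "(\<integral>\<^sup>+x. ennreal (A x * w x) \<partial>M) \<le> ennreal 4 * (\<integral>\<^sup>+x. ennreal (Y N x powr r) * ennreal (W N x) \<partial>M)"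
  proof -
    \<comment> \<open>Since \<open>r \<ge> 1\<close>, \<open>V\<close> increases with
      \<open>n\<close>. Dividing it by \<open>Y\<close> gives the power \<open>r - 2\<close> in
      \<open>a\<close>, multiplying by \<open>Y\<close> the power \<open>r\<close> of the
      result.\<close>
    define V where "V = (\<lambda>n x. Y n x powr (r - 1) * W n x)"
    have "(\<integral>\<^sup>+x. ennreal (A x * w x) \<partial>M) = (\<integral>\<^sup>+x. (\<Sum>n<N. ennreal (a n x) * ennreal (w x)) \<partial>M)"
      using a_nonneg w
      by (intro nn_integral_cong)
         (simp add: A_def sum_distrib_right[symmetric] sum_ennreal ennreal_mult[symmetric] sum_nonneg less_imp_le)
    also have "\<dots> = (\<Sum>n<N. \<integral>\<^sup>+x. ennreal (a n x) * ennreal (w x) \<partial>M)"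
      using aM w(1) by (intro nn_integral_sum) auto
    \<comment> \<open>The term \<open>a n\<close> involves \<open>f (Suc n)\<close>, hence the index
      \<open>Suc n\<close> of \<open>W\<close>.\<close>
    also have "\<dots> \<le> (\<Sum>n<N. \<integral>\<^sup>+x. ennreal (a n x) * ennreal (W (Suc n) x) \<partial>M)"
      using aF by (intro sum_mono W_dom) auto
    also have "\<dots> = (\<integral>\<^sup>+x. (\<Sum>n<N. ennreal (a n x) * ennreal (W (Suc n) x)) \<partial>M)"
      using aM WM by (intro nn_integral_sum[symmetric]) auto
    also have "\<dots> = (\<integral>\<^sup>+x. ennreal (\<Sum>n<N. V (Suc n) x * (norm (f (Suc n) x - f n x))\<^sup>2 / Y (Suc n) x) \<partial>M)"
    proof (rule nn_integral_cong)
      fix x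
      have "a n x * W (Suc n) x = V (Suc n) x * (norm (f (Suc n) x - f n x))\<^sup>2 / Y (Suc n) x" for n
      proof (cases "Y (Suc n) x = 0")
        case False
        then have "Y (Suc n) x powr (r - 2) = Y (Suc n) x powr (r - 1) / Y (Suc n) x"
          using Y_nonneg[of "Suc n" x] powr_diff[of "Y (Suc n) x" "r - 1" 1] by simp
        then show ?thesis by (simp add: a_def V_def d_def)
      qed (simp add: a_def)
      then show "(\<Sum>n<N. ennreal (a n x) * ennreal (W (Suc n) x))
          = ennreal (\<Sum>n<N. V (Suc n) x * (norm (f (Suc n) x - f n x))\<^sup>2 / Y (Suc n) x)"
        using a_nonneg W_nonneg by (simp add: sum_ennreal ennreal_mult[symmetric] flip: \<open>\<And>n. a n x * W (Suc n) x = _\<close>)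
    qed
    also have "\<dots> \<le> 4 * (\<integral>\<^sup>+x. ennreal (V N x * Y N x) \<partial>M)"
    proof (rule weighted_square_sum_le)
      show "V n \<in> borel_measurable (F n)" for n
        unfolding V_def using Y_adapted W_adapted by measurable
      show "0 \<le> V n x" for n x using W_nonneg by (simp add: V_def)
      show "V n x \<le> V (Suc n) x" for n x
        unfolding V_def using W_nonneg W_Suc r Y_nonneg Y_mono[of n "Suc n" x]
        by (intro mult_mono powr_mono2) auto
    qed
    also have "(\<integral>\<^sup>+x. ennreal (V N x * Y N x) \<partial>M) = (\<integral>\<^sup>+x. ennreal (Y N x powr r) * ennreal (W N x) \<partial>M)"
    proof (rule nn_integral_cong)
      fix x
      have "Y N x powr r = Y N x powr (r - 1) * Y N x"
        using Y_nonneg[of N x] powr_add[of "Y N x" "r - 1" 1] by simp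
      then show "ennreal (V N x * Y N x) = ennreal (Y N x powr r) * ennreal (W N x)"
        using W_nonneg Y_nonneg by (simp add: V_def ennreal_mult[symmetric] mult_ac)
    qed
    finally show ?thesis by simp
  qed

  \<comment> \<open>\<open>nn_integral_powr_Hoelder\<close> asks for nonnegativity everywhere,
    whereas \<open>w\<close> is positive only on \<open>space M\<close>.\<close>
  define w' where "w' = (\<lambda>x. max 0 (w x))"
  have w': "w' \<in> borel_measurable M" "0 \<le> w' x" "x \<in> space M \<Longrightarrow> w' x = w x" for x
    using w by (auto simp: w'_def max_def less_imp_le)
  have "(\<integral>\<^sup>+x. ennreal (sqrt (\<Sum>n<N. d n x) powr r) * ennreal (w x) \<partial>M)
      \<le> (\<integral>\<^sup>+x. ennreal ((A x * w' x) powr (r / 2) * (Y N x powr r * w' x) powr (1 - r / 2)) \<partial>M)"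
    using pointwise w(2) w'
    by (intro nn_integral_mono) (simp add: ennreal_mult[symmetric] less_imp_le ennreal_leI)
  also have "\<dots> \<le> ennreal_pow (\<integral>\<^sup>+x. ennreal (A x * w' x) \<partial>M) (r / 2)
      * ennreal_pow (\<integral>\<^sup>+x. ennreal (Y N x powr r * w' x) \<partial>M) (1 - r / 2)"
    using AM YM w' A_nonneg r by (intro nn_integral_powr_Hoelder) auto
  also have "(\<integral>\<^sup>+x. ennreal (A x * w' x) \<partial>M) = (\<integral>\<^sup>+x. ennreal (A x * w x) \<partial>M)"
    using w' by (intro nn_integral_cong) simp
  also have "(\<integral>\<^sup>+x. ennreal (Y N x powr r * w' x) \<partial>M) = (\<integral>\<^sup>+x. ennreal (Y N x powr r) * ennreal (w x) \<partial>M)"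
    using w' w(2) by (intro nn_integral_cong) (simp add: ennreal_mult less_imp_le)
  also have "ennreal_pow (\<integral>\<^sup>+x. ennreal (A x * w x) \<partial>M) (r / 2)
      \<le> ennreal (4 powr (r / 2)) * ennreal_pow (\<integral>\<^sup>+x. ennreal (Y N x powr r) * ennreal (W N x) \<partial>M) (r / 2)"
    using r by (intro order_trans[OF ennreal_pow_mono[OF A_le] ennreal_pow_mult_ennreal]) auto
  also have "(4::real) powr (r / 2) = 2 powr r"
    using powr_powr[of 2 2 "r / 2"] by simp
  finally show ?thesis
    by (simp add: d_def mult_ac mult_right_mono)
qed

end

text \<open>Almost everywhere the negative part contributes nothing and the nonnegative conditional
  expectation of \<open>w\<close> is finite, so the two notions agree. The defining identity of the
  latter holds for every \<open>[0,\<infinity>]\<close>-valued \<open>g\<close>.\<close>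

lemma (in sigma_finite_subalgebra) nn_integral_real_cond_exp_mult:
  assumes w: "integrable M w" "\<And>x. x \<in> space M \<Longrightarrow> 0 \<le> w x" and g: "g \<in> borel_measurable F"
  shows "(\<integral>\<^sup>+x. g x * ennreal (real_cond_exp M F w x) \<partial>M) = (\<integral>\<^sup>+x. g x * ennreal (w x) \<partial>M)"
proof -
  have wM: "w \<in> borel_measurable M" using w(1) by simp
  have "AE x in M. nn_cond_exp M F (\<lambda>x. ennreal (- w x)) x = nn_cond_exp M F (\<lambda>x. 0) x"
    using w(2) wM by (intro nn_cond_exp_cong AE_I2) (auto simp: ennreal_neg)
  moreover have "AE x in M. nn_cond_exp M F (\<lambda>x. 0) x = 0"
    using nn_cond_exp_F_meas[of "\<lambda>x. 0"] by auto
  moreover have "AE x in M. nn_cond_exp M F (\<lambda>x. ennreal (w x)) x \<noteq> \<infinity>"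
  proof (rule nn_integral_PInf_AE)
    have "(\<integral>\<^sup>+x. nn_cond_exp M F (\<lambda>x. ennreal (w x)) x \<partial>M) = (\<integral>\<^sup>+x. ennreal (w x) \<partial>M)"
      using nn_cond_exp_intg[of "\<lambda>x. 1" "\<lambda>x. ennreal (w x)"] wM by simp
    also have "\<dots> < \<infinity>"
      using w by (simp add: nn_integral_eq_integral)
    finally show "(\<integral>\<^sup>+x. nn_cond_exp M F (\<lambda>x. ennreal (w x)) x \<partial>M) \<noteq> \<infinity>" by simp
  qed simp
  ultimately have "AE x in M. ennreal (real_cond_exp M F w x) = nn_cond_exp M F (\<lambda>x. ennreal (w x)) x"
    by eventually_elim (simp add: real_cond_exp_def less_top)
  then have "(\<integral>\<^sup>+x. g x * ennreal (real_cond_exp M F w x) \<partial>M)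
      = (\<integral>\<^sup>+x. g x * nn_cond_exp M F (\<lambda>x. ennreal (w x)) x \<partial>M)"
    by (intro nn_integral_cong_AE) auto
  then show ?thesis
    using nn_cond_exp_intg[OF g, of "\<lambda>x. ennreal (w x)"] wM by simp
qed

theorem mainTheorem4:
  fixes M :: "'a measure"
    and F :: "nat \<Rightarrow> 'a measure"
    and f :: "nat \<Rightarrow> 'a \<Rightarrow> 'h::{real_inner, complete_space}"
    and w :: "'a \<Rightarrow> real"
    and r :: real
    and N :: nat
  assumes "prob_space M"
    and "filtration (space M) F"
    and "\<And>n. subalgebra M (F n)"
    and "martingale M F f"
    and "\<And>x. x \<in> space M \<Longrightarrow> f 0 x = 0"
    and "1 \<le> r" and "r \<le> 2"
    and "weight M w"
    and "integrable M w"
  shows "(\<integral>\<^sup>+x. ennreal_pow (ennreal (square_function f N x)) r * ennreal (w x) \<partial>M)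
     \<le> ennreal (2 powr r)
       * ennreal_pow (\<integral>\<^sup>+x. ennreal_pow (maximal_function f x) r * ennreal (w x) \<partial>M) (1 - r / 2)
       * ennreal_pow (\<integral>\<^sup>+x. ennreal_pow (maximal_function f x) r * maximal_weight M F w x \<partial>M) (r / 2)"
proof -
  interpret prob_space M by fact
  have mart: "bochner_integrable M (f n)" "f n \<in> borel_measurable (F n)"
    "is_cond_exp M (F n) (f (Suc n)) (f n)" for n
    using assms(4) by (auto simp: martingale_def)
  have from_F: "g \<in> borel_measurable M" if "g \<in> borel_measurable (F n)" for n and g :: "'a \<Rightarrow> 'h"
    using measurable_from_subalg[OF assms(3) that] .

  obtain D where D: "\<And>n. countable (D n)" "\<And>n. AE x in M. f n x \<in> closure (D n)"
    using bochner_integrable_separably_valued[OF mart(1)] by metis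
  \<comment> \<open>The point \<open>0\<close> makes \<open>E\<close> nonempty, so that it can be
    enumerated, and serves as the replacement value in \<open>f'\<close>.\<close>
  define E where "E = insert 0 (\<Union>n. D n)"
  define e where "e = from_nat_into E"
  have range_e: "range e = E"
    unfolding e_def using D(1) by (intro range_from_nat_into) (auto simp: E_def)
  \<comment> \<open>A fixed Borel map of the space applied to \<open>f n\<close>, so adaptedness is
    kept.\<close>
  define f' where "f' = (\<lambda>n x. if f n x \<in> closure E then f n x else 0)"
  have f_closure: "AE x in M. f n x \<in> closure E" for n
    using D(2)[of n] closure_mono[of "D n" E] by (auto simp: E_def elim!: eventually_mono)
  have f'_eq: "AE x in M. f n x = f' n x" for n
    using f_closure[of n] by (auto simp: f'_def elim!: eventually_mono)
  have f'_adapted: "f' n \<in> borel_measurable (F n)" for n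
  proof -
    have "(\<lambda>u. if u \<in> closure E then u else 0) \<in> borel_measurable borel"
      by (intro measurable_If_set) auto
    from measurable_compose[OF mart(2) this] show ?thesis
      by (simp add: f'_def)
  qed
  interpret f': separable_weak_martingale M F f' e
  proof (intro separable_weak_martingale.intro separable_weak_martingale_axioms.intro)
    show "finite_measure M" by unfold_locales
    show "filtration (space M) F" by fact
    show "subalgebra M (F n)" "f' n \<in> borel_measurable (F n)" for n
      using assms(3) f'_adapted by auto
    show "f' n x \<in> closure (range e)" for n x
      using closure_subset[of E] by (auto simp: f'_def range_e E_def)
    show "weak_cond_exp M (F n) (f' (Suc n)) (f' n)" for n
      by (rule weak_cond_exp_cong_AE[OF is_cond_exp_imp_weak_cond_exp[OF mart(3)] assms(3)
            from_F[OF f'_adapted] from_F[OF f'_adapted] f'_eq f'_eq])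
  qed

  \<comment> \<open>A version of the conditional expectation may be negative on a null set. The
    cutoff at \<open>0\<close> matches that of \<open>ennreal\<close> in
    \<open>maximal_weight\<close>, so \<open>W_le\<close> holds at every point.\<close>
  define W where "W = runmax (\<lambda>n x. max 0 (real_cond_exp M (F n) w x))"
  have W_adapted: "W n \<in> borel_measurable (F n)" for n
    unfolding W_def by (rule runmax_adapted[OF assms(2)]) simp
  have W_ge: "max 0 (real_cond_exp M (F n) w x) \<le> W n x" for n x
    unfolding W_def using runmax_ge[of "\<lambda>n x. max 0 (real_cond_exp M (F n) w x)"] .
  have W_nonneg: "0 \<le> W n x" and W_Suc: "W n x \<le> W (Suc n) x" for n x
    using order_trans[OF max.cobounded1 W_ge] by (simp_all add: W_def)
  have W_dom: "(\<integral>\<^sup>+x. g x * ennreal (w x) \<partial>M) \<le> (\<integral>\<^sup>+x. g x * ennreal (W n x) \<partial>M)"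
    if "g \<in> borel_measurable (F n)" for n g
  proof -
    interpret sub: finite_measure_subalgebra M "F n"
      using assms(3) by unfold_locales
    have "(\<integral>\<^sup>+x. g x * ennreal (w x) \<partial>M) = (\<integral>\<^sup>+x. g x * ennreal (real_cond_exp M (F n) w x) \<partial>M)"
      using assms(8,9) that
      by (intro sub.nn_integral_real_cond_exp_mult[symmetric]) (auto simp: weight_def less_imp_le)
    also have "\<dots> \<le> (\<integral>\<^sup>+x. g x * ennreal (W n x) \<partial>M)"
      using W_ge by (intro nn_integral_mono mult_left_mono ennreal_leI) auto
    finally show ?thesis .
  qed
  have W_le: "ennreal (W n x) \<le> maximal_weight M F w x" for n x
  proof -
    obtain k where "W n x = max 0 (real_cond_exp M (F k) w x)"
      unfolding W_def using runmax_attained[of n "\<lambda>n x. max 0 (real_cond_exp M (F n) w x)" x] by auto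
    then have "ennreal (W n x) = ennreal (real_cond_exp M (F k) w x)"
      by (simp add: max_def ennreal_neg)
    also have "\<dots> \<le> maximal_weight M F w x"
      unfolding maximal_weight_def by (rule SUP_upper) simp
    finally show ?thesis .
  qed
  have Y_le: "ennreal (f'.Y n x powr r) \<le> ennreal_pow (maximal_function f x) r" for n x
  proof -
    obtain k where "f'.Y n x = norm (f' k x)"
      unfolding f'.Y_def using runmax_attained[of n "\<lambda>n x. norm (f' n x)" x] by auto
    \<comment> \<open>Each \<open>f' k x\<close> is \<open>f k x\<close> or \<open>0\<close>, so the
      comparison with the maximal function holds at every point.\<close>
    then have "ennreal (f'.Y n x) \<le> ennreal (norm (f k x))"
      by (simp add: f'_def)
    also have "\<dots> \<le> maximal_function f x"
      unfolding maximal_function_def by (rule SUP_upper) simp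
    finally have "ennreal_pow (ennreal (f'.Y n x)) r \<le> ennreal_pow (maximal_function f x) r"
      using assms(6) by (intro ennreal_pow_mono) auto
    then show ?thesis
      using assms(6) f'.Y_nonneg by (simp add: ennreal_pow_ennreal)
  qed

  have "AE x in M. \<forall>n. f n x = f' n x"
    using f'_eq by (simp add: AE_all_countable)
  then have "(\<integral>\<^sup>+x. ennreal_pow (ennreal (square_function f N x)) r * ennreal (w x) \<partial>M)
    = (\<integral>\<^sup>+x. ennreal (sqrt (\<Sum>n<N. (norm (f' (Suc n) x - f' n x))\<^sup>2) powr r) * ennreal (w x) \<partial>M)"
  proof (intro nn_integral_cong_AE, eventually_elim)
    case (elim x)
    have "square_function f N x = sqrt (\<Sum>n<N. (norm (f' (Suc n) x - f' n x))\<^sup>2)"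
      by (simp add: square_function_def mdiff_def sum.atLeast1_atMost_eq elim)
    then show ?case
      using assms(6) by (simp add: ennreal_pow_ennreal sum_nonneg)
  qed
  also have "\<dots> \<le> ennreal (2 powr r)
      * ennreal_pow (\<integral>\<^sup>+x. ennreal (f'.Y N x powr r) * ennreal (w x) \<partial>M) (1 - r / 2)
      * ennreal_pow (\<integral>\<^sup>+x. ennreal (f'.Y N x powr r) * ennreal (W N x) \<partial>M) (r / 2)"
    using assms(6-9) W_adapted W_nonneg W_Suc W_dom
    by (intro f'.square_function_weighted_le) (auto simp: weight_def)
  also have "\<dots> \<le> ennreal (2 powr r)
       * ennreal_pow (\<integral>\<^sup>+x. ennreal_pow (maximal_function f x) r * ennreal (w x) \<partial>M) (1 - r / 2)
       * ennreal_pow (\<integral>\<^sup>+x. ennreal_pow (maximal_function f x) r * maximal_weight M F w x \<partial>M) (r / 2)"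
    using assms(6,7) Y_le W_le
    by (intro mult_mono ennreal_pow_mono nn_integral_mono order_refl) auto
  finally show ?thesis .
qed

end
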